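(* Let $\mathfrak{g}=\mathfrak{g}_{3.1}\oplus\mathfrak{g}_1$ be the four-dimensional real Lie algebra with basis $\mathcal{B}=\{e_1,e_2,e_3,e_4\}$ whose only nonzero Lie bracket (up to skew-symmetry) is $[e_2,e_3]=e_1$. Let $\langle\cdot,\cdot\rangle$ be a pseudo-Riemannian inner product on $\mathfrak{g}$ and let $(R_{ij})$ be the matrix of its Ricci operator $\operatorname{Ric}$ in the basis $\mathcal{B}$. If $$R_{21}=R_{31}=R_{41}=R_{24}=R_{34}=0,$$ then $\langle\cdot,\cdot\rangle$ is an algebraic Ricci soliton. Under these conditions, $\operatorname{Ric}=\eta I_4+D$ where $\eta=R_{22}+R_{33}-R_{11}$ and $$D=\begin{bmatrix}R_{11}-\eta&R_{12}&R_{13}&R_{14}\\0&R_{22}-\eta&R_{23}&0\\0&R_{32}&R_{33}-\eta&0\\0&R_{42}&R_{43}&R_{44}-\eta\end{bmatrix}$$ is (the matrix in the basis $\mathcal{B}$ of) a derivation of $\mathfrak{g}$.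
   Context: A pseudo-Riemannian inner product on a real Lie algebra $\mathfrak{g}$ is a nondegenerate symmetric bilinear form $\langle\cdot,\cdot\rangle$ on $\mathfrak{g}$ (of some signature $(r,s)$). Its Levi-Civita connection $\nabla$ is defined by $2\langle\nabla_uv,w\rangle=\langle[u,v],w\rangle+\langle[w,u],v\rangle+\langle[w,v],u\rangle$; its curvature is $R_{uv}=\nabla_{[u,v]}-[\nabla_u,\nabla_v]$; its Ricci curvature $\operatorname{ric}(u,v)$ is the trace of $w\mapsto R_{uw}v$; its Ricci operator $\operatorname{Ric}$ is the endomorphism of $\mathfrak{g}$ with $\langle\operatorname{Ric}(u),v\rangle=\operatorname{ric}(u,v)$. The matrix $(R_{ij})$ of $\operatorname{Ric}$ in a basis $\{e_i\}$ is given by $\operatorname{Ric}(e_j)=\sum_iR_{ij}e_i$ (the same column convention is used for $D$). A derivation is a linear map $D:\mathfrak{g}\to\mathfrak{g}$ with $D[x,y]=[D(x),y]+[x,D(y)]$ for all $x,y$. The inner product is an algebraic Ricci soliton if $\operatorname{Ric}=\eta\,\mathrm{Id}_{\mathfrak{g}}+D$ for some $\eta\in\mathbb{R}$ and some derivation $D$ of $\mathfrak{g}$. *)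

theory Defs
  imports "HOL-Analysis.Analysis"
begin

definition lie_bracket :: "('a::real_vector \<Rightarrow> 'a \<Rightarrow> 'a) \<Rightarrow> bool" where
  "lie_bracket br \<longleftrightarrow> bilinear br \<and> (\<forall>x. br x x = 0) \<and>
     (\<forall>x y z. br x (br y z) + br y (br z x) + br z (br x y) = 0)"

definition lie_derivation :: "('a::real_vector \<Rightarrow> 'a \<Rightarrow> 'a) \<Rightarrow> ('a \<Rightarrow> 'a) \<Rightarrow> bool" where
  "lie_derivation br D \<longleftrightarrow> linear D \<and> (\<forall>x y. D (br x y) = br (D x) y + br x (D y))"

definition pseudo_riemannian_inner_product :: "('a::real_vector \<Rightarrow> 'a \<Rightarrow> real) \<Rightarrow> bool" where
  "pseudo_riemannian_inner_product g \<longleftrightarrow>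
     bilinear g \<and> (\<forall>u v. g u v = g v u) \<and> (\<forall>u. (\<forall>v. g u v = 0) \<longrightarrow> u = 0)"

text \<open>
  In the following, \<open>br\<close> is the Lie bracket and \<open>g\<close> the inner product. The definite
  descriptions are legitimate by lemmas \<open>levi_civita_eq\<close> and \<open>ricci_operator_eq\<close> below.
\<close>

definition levi_civita ::
    "('a::real_vector \<Rightarrow> 'a \<Rightarrow> 'a) \<Rightarrow> ('a \<Rightarrow> 'a \<Rightarrow> real) \<Rightarrow> 'a \<Rightarrow> 'a \<Rightarrow> 'a" where
  "levi_civita br g u v =
     (THE x. \<forall>w. 2 * g x w = g (br u v) w + g (br w u) v + g (br w v) u)"

text \<open>Sign convention: \<open>R\<^sub>u\<^sub>v = \<nabla>\<^bsub>[u,v]\<^esub> - [\<nabla>\<^sub>u, \<nabla>\<^sub>v]\<close>.\<close>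

definition curvature ::
    "('a::real_vector \<Rightarrow> 'a \<Rightarrow> 'a) \<Rightarrow> ('a \<Rightarrow> 'a \<Rightarrow> real) \<Rightarrow> 'a \<Rightarrow> 'a \<Rightarrow> 'a \<Rightarrow> 'a" where
  "curvature br g u v w =
     levi_civita br g (br u v) w
     - (levi_civita br g u (levi_civita br g v w) - levi_civita br g v (levi_civita br g u w))"

definition ricci ::
    "(real^'n \<Rightarrow> real^'n \<Rightarrow> real^'n) \<Rightarrow> (real^'n \<Rightarrow> real^'n \<Rightarrow> real) \<Rightarrow> real^'n \<Rightarrow> real^'n \<Rightarrow> real" where
  "ricci br g u v = trace (matrix (\<lambda>w. curvature br g u w v))"

definition ricci_operator ::
    "(real^'n \<Rightarrow> real^'n \<Rightarrow> real^'n) \<Rightarrow> (real^'n \<Rightarrow> real^'n \<Rightarrow> real) \<Rightarrow> real^'n \<Rightarrow> real^'n" where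
  "ricci_operator br g u = (THE x. \<forall>v. g x v = ricci br g u v)"

definition algebraic_ricci_soliton ::
    "(real^'n \<Rightarrow> real^'n \<Rightarrow> real^'n) \<Rightarrow> (real^'n \<Rightarrow> real^'n \<Rightarrow> real) \<Rightarrow> bool" where
  "algebraic_ricci_soliton br g \<longleftrightarrow>
     (\<exists>\<eta> D. lie_derivation br D \<and> ricci_operator br g = (\<lambda>x. \<eta> *\<^sub>R x + D x))"

text \<open>
  The Lie algebra \<open>\<gg>\<^sub>3\<^sub>.\<^sub>1 \<oplus> \<gg>\<^sub>1\<close>, realised on \<open>\<real>\<^sup>4\<close> with \<open>e\<^sub>i = axis i 1\<close>; see
  \<open>br_g31_g1_basis\<close>.
\<close>

definition br_g31_g1 :: "real^4 \<Rightarrow> real^4 \<Rightarrow> real^4" where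
  "br_g31_g1 x y = (x $ 2 * y $ 3 - x $ 3 * y $ 2) *\<^sub>R axis 1 1"

lemma lie_bracket_br_g31_g1: "lie_bracket br_g31_g1"
  unfolding lie_bracket_def bilinear_def br_g31_g1_def
  by (auto intro!: linearI simp: vec_eq_iff axis_def algebra_simps)

lemma br_g31_g1_basis:
  "br_g31_g1 (axis i 1) (axis j 1) =
     (if i = 2 \<and> j = 3 then axis 1 1 else if i = 3 \<and> j = 2 then - axis 1 1 else 0)"
  by (auto simp: br_g31_g1_def axis_def)

lemma vector_4:
  "(vector [a, b, c, d] :: 'a::zero^4) $ 1 = a"
  "(vector [a, b, c, d] :: 'a::zero^4) $ 2 = b"
  "(vector [a, b, c, d] :: 'a::zero^4) $ 3 = c"
  "(vector [a, b, c, d] :: 'a::zero^4) $ 4 = d"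
  unfolding vector_def by simp_all

lemma pseudo_riemannian_riesz:
  fixes g :: "'a::euclidean_space \<Rightarrow> 'a \<Rightarrow> real"
  assumes g: "pseudo_riemannian_inner_product g" and f: "linear f"
  shows "\<exists>!x. \<forall>w. g x w = f w"
proof -
  have bl: "bilinear g" and nd: "\<And>u. (\<And>v. g u v = 0) \<Longrightarrow> u = 0"
    using g by (auto simp: pseudo_riemannian_inner_product_def)
  have l1: "linear (\<lambda>x. g x w)" and l2: "linear (g x)" for x w
    using bl by (auto simp: bilinear_def)
  define T where "T x = (\<Sum>b\<in>Basis. g x b *\<^sub>R b)" for x
  have T: "linear T"
    unfolding T_def
    by (rule linearI) (simp_all add: linear_add[OF l1] linear_cmul[OF l1] scaleR_add_left
      sum.distrib scaleR_sum_right)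
  have expand: "h w = (\<Sum>b\<in>Basis. (w \<bullet> b) * h b)" if "linear h" for h :: "'a \<Rightarrow> real" and w
  proof -
    have "h w = h (\<Sum>b\<in>Basis. (w \<bullet> b) *\<^sub>R b)" by (simp add: euclidean_representation)
    also have "\<dots> = (\<Sum>b\<in>Basis. (w \<bullet> b) * h b)"
      by (simp add: linear_sum[OF that] linear_cmul[OF that])
    finally show ?thesis .
  qed
  have Tb: "T x \<bullet> b = g x b" if "b \<in> Basis" for x b
    unfolding T_def using that by simp
  have "inj T"
    unfolding linear_injective_0[OF T]
  proof (intro allI impI)
    fix x assume "T x = 0"
    then have "g x b = 0" if "b \<in> Basis" for b using Tb[OF that, of x] by simp
    then have "g x w = 0" for w using expand[OF l2, of x w] by simp
    then show "x = 0" by (rule nd)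
  qed
  then have "surj T" using T by (simp add: linear_injective_imp_surjective)
  then obtain x where x: "T x = (\<Sum>b\<in>Basis. f b *\<^sub>R b)" by (metis surjD)
  have "g x b = f b" if "b \<in> Basis" for b
    using that by (simp add: Tb[OF that, symmetric] x)
  then have "g x w = f w" for w
    using expand[OF l2, of x w] expand[OF f, of w] by simp
  moreover have "y = x" if "\<forall>w. g y w = f w" for y
  proof -
    have "g (y - x) w = 0" for w
      using that calculation[of w] by (simp add: linear_diff[OF l1])
    then show ?thesis using nd[of "y - x"] by simp
  qed
  ultimately show ?thesis by blast
qed

lemma levi_civita_eq:
  fixes g :: "'a::euclidean_space \<Rightarrow> 'a \<Rightarrow> real"
  assumes g: "pseudo_riemannian_inner_product g" and br: "lie_bracket br"
  shows "2 * g (levi_civita br g u v) w = g (br u v) w + g (br w u) v + g (br w v) u"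
proof -
  let ?f = "\<lambda>w. (g (br u v) w + g (br w u) v + g (br w v) u) / 2"
  have l: "linear (\<lambda>x. g x a)" "linear (g a)" "linear (\<lambda>x. br x a)" for a
    using g br by (auto simp: pseudo_riemannian_inner_product_def lie_bracket_def bilinear_def)
  have "linear ?f"
    by (rule linearI) (simp_all add: linear_add[OF l(1)] linear_add[OF l(2)] linear_add[OF l(3)]
      linear_cmul[OF l(1)] linear_cmul[OF l(2)] linear_cmul[OF l(3)] field_simps)
  from pseudo_riemannian_riesz[OF g this]
  have "\<exists>!x. \<forall>w. 2 * g x w = g (br u v) w + g (br w u) v + g (br w v) u"
    by (simp add: field_simps)
  from theI'[OF this] show ?thesis by (simp add: levi_civita_def)
qed

lemma bilinear_levi_civita:
  fixes g :: "'a::euclidean_space \<Rightarrow> 'a \<Rightarrow> real"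
  assumes g: "pseudo_riemannian_inner_product g" and br: "lie_bracket br"
  shows "bilinear (levi_civita br g)"
proof -
  have bl: "linear (\<lambda>x. g x a)" "linear (g a)" "linear (\<lambda>x. br x a)" "linear (br a)" for a
    using g br by (auto simp: pseudo_riemannian_inner_product_def lie_bracket_def bilinear_def)
  note s = linear_add[OF bl(1)] linear_add[OF bl(2)] linear_add[OF bl(3)] linear_add[OF bl(4)]
    linear_cmul[OF bl(1)] linear_cmul[OF bl(2)] linear_cmul[OF bl(3)] linear_cmul[OF bl(4)]
  have eqI: "x = y" if "\<And>w. 2 * g x w = 2 * g y w" for x y
  proof -
    have "g (x - y) w = 0" for w using that[of w] by (simp add: linear_diff[OF bl(1)])
    moreover have "\<forall>u. (\<forall>v. g u v = 0) \<longrightarrow> u = 0"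
      using g by (simp add: pseudo_riemannian_inner_product_def)
    ultimately have "x - y = 0" by blast
    then show ?thesis by simp
  qed
  note e = levi_civita_eq[OF g br]
  show ?thesis
    unfolding bilinear_def
  proof (intro conjI allI linearI; rule eqI)
    fix x a b w
    show "2 * g (levi_civita br g x (a + b)) w = 2 * g (levi_civita br g x a + levi_civita br g x b) w"
      using e[of x a w] e[of x b w] e[of x "a + b" w] by (simp add: s)
    show "2 * g (levi_civita br g (a + b) x) w = 2 * g (levi_civita br g a x + levi_civita br g b x) w"
      using e[of a x w] e[of b x w] e[of "a + b" x w] by (simp add: s)
  next
    fix x a w and r :: real
    have "2 * g (levi_civita br g x (r *\<^sub>R a)) w = r * (2 * g (levi_civita br g x a) w)"
      unfolding e by (simp add: s algebra_simps)
    then show "2 * g (levi_civita br g x (r *\<^sub>R a)) w = 2 * g (r *\<^sub>R levi_civita br g x a) w"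
      by (simp add: s)
    have "2 * g (levi_civita br g (r *\<^sub>R a) x) w = r * (2 * g (levi_civita br g a x) w)"
      unfolding e by (simp add: s algebra_simps)
    then show "2 * g (levi_civita br g (r *\<^sub>R a) x) w = 2 * g (r *\<^sub>R levi_civita br g a x) w"
      by (simp add: s)
  qed
qed

lemma bilinear_ricci:
  fixes g :: "real^'n \<Rightarrow> real^'n \<Rightarrow> real"
  assumes g: "pseudo_riemannian_inner_product g" and br: "lie_bracket br"
  shows "bilinear (ricci br g)"
proof -
  let ?n = "levi_civita br g"
  have l: "linear (\<lambda>x. ?n x a)" "linear (?n a)" "linear (\<lambda>x. br x a)" "linear (br a)" for a
    using bilinear_levi_civita[OF g br] br by (auto simp: lie_bracket_def bilinear_def)
  show ?thesis
    unfolding bilinear_def ricci_def curvature_def trace_def matrix_def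
    by (intro conjI allI linearI)
      (simp_all add: linear_add[OF l(1)] linear_add[OF l(2)] linear_add[OF l(3)]
        linear_cmul[OF l(1)] linear_cmul[OF l(2)] linear_cmul[OF l(3)]
        sum.distrib[symmetric] sum_distrib_left algebra_simps)
qed

lemma ricci_operator_eq:
  fixes g :: "real^'n \<Rightarrow> real^'n \<Rightarrow> real"
  assumes g: "pseudo_riemannian_inner_product g" and br: "lie_bracket br"
  shows "g (ricci_operator br g u) v = ricci br g u v"
proof -
  have "linear (ricci br g u)" using bilinear_ricci[OF g br] by (simp add: bilinear_def)
  from theI'[OF pseudo_riemannian_riesz[OF g this]] show ?thesis
    by (simp add: ricci_operator_def)
qed

end

theory Submission
  imports Defs
begin

text \<open>
  No curvature has to be computed. The vanishing entries turn \<open>Ric = \<eta> I + D\<close> into an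
  identity of matrices, for every \<open>\<eta>\<close>. They also make \<open>D\<close> preserve the derived algebra
  \<open>\<langle>e\<^sub>1\<rangle>\<close> and the centre \<open>\<langle>e\<^sub>1, e\<^sub>4\<rangle>\<close>, so the only condition left for
  \<open>D\<close> to be a derivation is \<open>D[e\<^sub>2, e\<^sub>3] = [D e\<^sub>2, e\<^sub>3] + [e\<^sub>2, D e\<^sub>3]\<close>, that
  is, \<open>R\<^sub>1\<^sub>1 - \<eta> = R\<^sub>2\<^sub>2 + R\<^sub>3\<^sub>3 - 2 \<eta>\<close>.
\<close>

text \<open>By nondegeneracy a vector is determined by its \<open>g\<close>-pairings, so linearity
  of \<open>ricci\<close> in its first argument passes to the operator.\<close>

lemma linear_ricci_operator:
  fixes g :: "real^'n \<Rightarrow> real^'n \<Rightarrow> real"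
  assumes g: "pseudo_riemannian_inner_product g" and br: "lie_bracket br"
  shows "linear (ricci_operator br g)"
proof -
  have l: "linear (\<lambda>x. g x w)" "linear (\<lambda>x. ricci br g x w)" for w
    using g bilinear_ricci[OF g br] by (auto simp: pseudo_riemannian_inner_product_def bilinear_def)
  have eqI: "x = y" if "\<And>w. g x w = g y w" for x y
  proof -
    have "g (x - y) w = 0" for w using that[of w] by (simp add: linear_diff[OF l(1)])
    then have "x - y = 0" using g unfolding pseudo_riemannian_inner_product_def by blast
    then show ?thesis by simp
  qed
  show ?thesis
    by (rule linearI; rule eqI)
      (simp_all add: linear_add[OF l(1)] linear_cmul[OF l(1)] ricci_operator_eq[OF g br]
        linear_add[OF l(2)] linear_cmul[OF l(2)])
qed

text \<open>The bracket is \<open>axis 1 1\<close> times the determinant of coordinates 2 and 3, on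
  which \<open>D\<close> acts infinitesimally by the trace of its middle block.\<close>

lemma lie_derivation_br_g31_g1:
  fixes D :: "real^4^4"
  assumes "D $ 2 $ 1 = 0" "D $ 3 $ 1 = 0" "D $ 4 $ 1 = 0" "D $ 2 $ 4 = 0" "D $ 3 $ 4 = 0"
    and "D $ 1 $ 1 = D $ 2 $ 2 + D $ 3 $ 3"
  shows "lie_derivation br_g31_g1 (\<lambda>x. D *v x)"
  unfolding lie_derivation_def
  using assms
  by (auto simp: br_g31_g1_def vec_eq_iff forall_4 matrix_vector_mult_def sum_4 axis_def
      algebra_simps)

theorem theorem3p3:
  fixes g :: "real^4 \<Rightarrow> real^4 \<Rightarrow> real"
    and R :: "real^4^4"
  assumes "pseudo_riemannian_inner_product g"
    and "R = matrix (ricci_operator br_g31_g1 g)"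
    and "R $ 2 $ 1 = 0" and "R $ 3 $ 1 = 0" and "R $ 4 $ 1 = 0"
    and "R $ 2 $ 4 = 0" and "R $ 3 $ 4 = 0"
  shows "algebraic_ricci_soliton br_g31_g1 g \<and>
    (let \<eta> = R $ 2 $ 2 + R $ 3 $ 3 - R $ 1 $ 1;
         D = (vector
           [vector [R $ 1 $ 1 - \<eta>, R $ 1 $ 2, R $ 1 $ 3, R $ 1 $ 4],
            vector [0, R $ 2 $ 2 - \<eta>, R $ 2 $ 3, 0],
            vector [0, R $ 3 $ 2, R $ 3 $ 3 - \<eta>, 0],
            vector [0, R $ 4 $ 2, R $ 4 $ 3, R $ 4 $ 4 - \<eta>]] :: real^4^4)
     in ricci_operator br_g31_g1 g = (\<lambda>x. \<eta> *\<^sub>R x + D *v x) \<and>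
        R = \<eta> *\<^sub>R mat 1 + D \<and>
        lie_derivation br_g31_g1 (\<lambda>x. D *v x))"
proof -
  define \<eta> where "\<eta> = R $ 2 $ 2 + R $ 3 $ 3 - R $ 1 $ 1"
  define D :: "real^4^4" where "D = vector
     [vector [R $ 1 $ 1 - \<eta>, R $ 1 $ 2, R $ 1 $ 3, R $ 1 $ 4],
      vector [0, R $ 2 $ 2 - \<eta>, R $ 2 $ 3, 0],
      vector [0, R $ 3 $ 2, R $ 3 $ 3 - \<eta>, 0],
      vector [0, R $ 4 $ 2, R $ 4 $ 3, R $ 4 $ 4 - \<eta>]]"
  have RD: "R = \<eta> *\<^sub>R mat 1 + D"
    using assms(3-7) by (simp add: vec_eq_iff forall_4 D_def vector_4 mat_def)
  \<comment> \<open>\<open>matrix\<close> records only values on basis vectors, so linearity is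
    needed here.\<close>
  have "ricci_operator br_g31_g1 g x = R *v x" for x
    using matrix_vector_mul(2)[OF linear_ricci_operator[OF assms(1) lie_bracket_br_g31_g1]]
    by (simp add: assms(2) fun_eq_iff)
  then have ric: "ricci_operator br_g31_g1 g = (\<lambda>x. \<eta> *\<^sub>R x + D *v x)"
    by (simp add: fun_eq_iff RD matrix_vector_mult_add_rdistrib scaleR_matrix_vector_assoc[symmetric])
  have der: "lie_derivation br_g31_g1 (\<lambda>x. D *v x)"
    by (rule lie_derivation_br_g31_g1) (simp_all add: D_def vector_4 \<eta>_def)
  have "algebraic_ricci_soliton br_g31_g1 g"
    unfolding algebraic_ricci_soliton_def using der ric by blast
  with RD ric der show ?thesis
    unfolding Let_def \<eta>_def[symmetric] D_def[symmetric] by blast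
qed

end
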